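(* Let $\mathbf{k}$ be a field of characteristic zero and let $L^{-2}\xrightarrow{d}L^{-1}\xrightarrow{d}\bar L^0$ be any differential graded Lie algebra over $\mathbf{k}$ concentrated in degrees $-2,-1,0$, with bracket $\{\cdot,\cdot\}$. Set $C^{-1}=L^{-2}$, $C^0=L^{-1}$ with differential $d:C^{-1}\to C^0$ and, for $x,y\in C^0$, $a\in C^{-1}$, $$[x,y]=\{dx,y\},\quad[x,a]=\{dx,a\},\quad[a,x]=0,\quad\langle x,y\rangle=\{x,y\}.$$ Let $\partial:\Gamma(C)\to\bar L^0$ be the linear functor $\Gamma(d,0)$, i.e. $\partial(x,a)=dx$, where $\bar L^0$ is viewed as a linear category with only identity arrows. Then: (1) with this bracket, the alternator determined by $\langle\cdot,\cdot\rangle$ and trivial Jacobiator, $\Gamma(C)$ is a hemistrict Lie 2-algebra; (2) $\partial:\Gamma(C)\to\bar L^0$ is a morphism of Lie 2-algebras; (3) $\bar L^0$ acts on $\Gamma(C)$ by strict derivations, via $T\mapsto\{T,\cdot\}$, i.e. $\{T,(x,a)\}=(\{T,x\},\{T,a\})$. In addition, the following crossed module identities hold for all $T\in\bar L^0$ and $\mathbf f,\mathbf g\in\Gamma(C)$: $$\partial\{T,\mathbf f\}=\{T,\partial\mathbf f\},\qquad\{\partial\mathbf f,\mathbf g\}=[\mathbf f,\mathbf g].$$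
   Context: Gradings are cohomological ($d$ has degree $+1$). (In the paper such a 3-term dgla arises from a dgla $(L,\delta)$ concentrated in degrees $\geq-2$ and a Maurer--Cartan element $\gamma\in L^1$ by putting $d=\delta+\{\gamma,\cdot\}$ and $\bar L^0=\ker(d|_{L^0})$.) The bracket $L^{-1}\otimes L^{-1}\to L^{-2}$ is symmetric. **Linear categories.** A linear category is a category internal to $\mathbf{k}$-vector spaces; linear functors and natural transformations are those with linear structure maps; the tensor product is taken separately on objects and arrows. For a 2-term complex $C=(C^{-1}\xrightarrow{d}C^0)$, $\Gamma(C)$ is the linear category with objects $C^0$, arrows $C^0\oplus C^{-1}$, source $(x,a)\mapsto x$, target $(x,a)\mapsto x+da$, identities $1_x=(x,0)$ and composition $(x+da,b)(x,a)=(x,a+b)$. Objects appearing in arrow expressions denote their identity arrows. **Lie 2-algebras.** A Lie 2-algebra is a linear category $L$ with a bilinear functor $[\cdot,\cdot]:L\otimes L\to L$, a bilinear natural transformation $S_{x,y}:[x,y]\to-[y,x]$ (alternator) and a trilinear natural transformation $J_{x,y,z}:[x,[y,z]]\to[[x,y],z]+[y,[x,z]]$ (Jacobiator), such that for all objects $x,y,z,w$, with $\hat J_{x,y,z}=J_{x,y,z}^{-1}-1_{[y,[x,z]]}$: (L1) $([J_{x,y,z},w]+1_{[[y,z],[x,w]]}+1_{[[x,z],[y,w]]}+[z,J_{x,y,w}])\circ(J_{x,[y,z],w}+J_{x,z,[y,w]})\circ[x,J_{y,z,w}]=(1_{[[[x,y],z],w]}+1_{[z,[[x,y],w]]}+J_{y,[x,z],w}+J_{y,z,[x,w]})\circ(J_{[x,y],z,w}+[y,J_{x,z,w}])\circ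 J_{x,y,[z,w]}$; (L2) $(-\hat J_{y,x,z})\circ[S_{x,y},z]=\hat J_{x,y,z}$; (L3) $(-J_{x,z,y})\circ[x,S_{y,z}]=(S_{[x,y],z}+S_{y,[x,z]})\circ J_{x,y,z}$; (L4) $(-S_{[y,z],x})\circ S_{x,[y,z]}=1_{[x,[y,z]]}$. It is hemistrict if $J$ is the identity (in particular $[x,[y,z]]=[[x,y],z]+[y,[x,z]]$). A Lie algebra is a Lie 2-algebra with only identity arrows. A morphism $(F,F^2):L\to L'$ is a linear functor $F$ with a linear natural transformation $F^2_{x,y}:[F(x),F(y)]'\to F([x,y])$ such that $F(S_{x,y})\circ F^2_{x,y}=(-F^2_{y,x})\circ S'_{F(x),F(y)}$ and $F(J_{x,y,z})\circ F^2_{x,[y,z]}\circ[F(x),F^2_{y,z}]'=(F^2_{[x,y],z}+F^2_{y,[x,z]})\circ([F^2_{x,y},F(z)]'+[F(y),F^2_{x,z}]')\circ J'_{F(x),F(y),F(z)}$. For $\partial$, whose target has only identity arrows, $\partial^2$ is the identity. On $\Gamma(C)$ the bracket is $[(x,a),(y,b)]=([x,y],[x,b]+[a,y]+[a,b])$ with derived bracket $[a,b]:=[da,b]=[a,db]$, and the alternator is $S_{x,y}=([x,y],-\langle x,y\rangle)$. Acting by strict derivations means: $T\mapsto\{T,\cdot\}$ is a Lie algebra action of $\bar L^0$ by linear endofunctors of $\Gamma(C)$ with $\{T,[\mathbf f,\mathbf g]\}=[\{T,\mathbf f\},\mathbf g]+[\mathbf f,\{T,\mathbf g\}]$ for all arrows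 $\mathbf f,\mathbf g$ and $\{T,\langle x,y\rangle\}=\langle\{T,x\},y\rangle+\langle x,\{T,y\}\rangle$ for all objects $x,y$. *)

theory Defs
  imports Complex_Main "HOL-Library.Product_Plus"
begin

text \<open>
  Vector spaces over a field are subspaces of an ambient vector space
  (\<^locale>\<open>vector_space\<close>); all operations below are only constrained on these carriers.
\<close>

definition linear_on ::
  "('k \<Rightarrow> 'a \<Rightarrow> 'a) \<Rightarrow> ('k \<Rightarrow> 'b \<Rightarrow> 'b) \<Rightarrow> 'a set \<Rightarrow> 'b set \<Rightarrow> ('a::ab_group_add \<Rightarrow> 'b::ab_group_add) \<Rightarrow> bool"
  where "linear_on s t A B f \<longleftrightarrow>
    (\<forall>x\<in>A. f x \<in> B) \<and> (\<forall>x\<in>A. \<forall>y\<in>A. f (x + y) = f x + f y) \<and> (\<forall>c. \<forall>x\<in>A. f (s c x) = t c (f x))"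

definition bilinear_on ::
  "('k \<Rightarrow> 'a \<Rightarrow> 'a) \<Rightarrow> ('k \<Rightarrow> 'b \<Rightarrow> 'b) \<Rightarrow> ('k \<Rightarrow> 'c \<Rightarrow> 'c) \<Rightarrow> 'a set \<Rightarrow> 'b set \<Rightarrow> 'c set \<Rightarrow>
    ('a::ab_group_add \<Rightarrow> 'b::ab_group_add \<Rightarrow> 'c::ab_group_add) \<Rightarrow> bool"
  where "bilinear_on s t u A B C f \<longleftrightarrow>
    (\<forall>x\<in>A. linear_on t u B C (\<lambda>y. f x y)) \<and> (\<forall>y\<in>B. linear_on s u A C (\<lambda>x. f x y))"

definition trilinear_on ::
  "('k \<Rightarrow> 'a \<Rightarrow> 'a) \<Rightarrow> ('k \<Rightarrow> 'b \<Rightarrow> 'b) \<Rightarrow> 'a set \<Rightarrow> 'b set \<Rightarrow>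
    ('a::ab_group_add \<Rightarrow> 'a \<Rightarrow> 'a \<Rightarrow> 'b::ab_group_add) \<Rightarrow> bool"
  where "trilinear_on s t A B f \<longleftrightarrow>
    (\<forall>x\<in>A. \<forall>y\<in>A. linear_on s t A B (\<lambda>z. f x y z)) \<and>
    (\<forall>x\<in>A. \<forall>z\<in>A. linear_on s t A B (\<lambda>y. f x y z)) \<and>
    (\<forall>y\<in>A. \<forall>z\<in>A. linear_on s t A B (\<lambda>x. f x y z))"


section \<open>Differential graded Lie algebras\<close>

text \<open>
  \<open>V i\<close> is the component of degree \<open>i\<close>, \<open>d i\<close> the differential \<open>V i \<rightarrow> V (i + 1)\<close> and \<open>br i j\<close>
  the bracket \<open>V i \<otimes> V j \<rightarrow> V (i + j)\<close>. The components need not be independent in the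
  ambient space: the maps are indexed by the degrees.
\<close>

locale dgla = vector_space sc
  for sc :: "'k::field \<Rightarrow> 'v::ab_group_add \<Rightarrow> 'v" +
  fixes V :: "int \<Rightarrow> 'v set"
    and d :: "int \<Rightarrow> 'v \<Rightarrow> 'v"
    and br :: "int \<Rightarrow> int \<Rightarrow> 'v \<Rightarrow> 'v \<Rightarrow> 'v"
  assumes subspace_V: "subspace (V i)"
    and d_linear: "linear_on sc sc (V i) (V (i + 1)) (d i)"
    and d_d: "x \<in> V i \<Longrightarrow> d (i + 1) (d i x) = 0"
    and br_bilinear: "bilinear_on sc sc sc (V i) (V j) (V (i + j)) (br i j)"
    and br_antisym: "x \<in> V i \<Longrightarrow> y \<in> V j \<Longrightarrow>
      br i j x y = - sc ((-1) powi (i * j)) (br j i y x)"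
    and br_jacobi: "x \<in> V i \<Longrightarrow> y \<in> V j \<Longrightarrow> z \<in> V k \<Longrightarrow>
      br i (j + k) x (br j k y z) =
        br (i + j) k (br i j x y) z + sc ((-1) powi (i * j)) (br j (i + k) y (br i k x z))"
    and d_br: "x \<in> V i \<Longrightarrow> y \<in> V j \<Longrightarrow>
      d (i + j) (br i j x y) = br (i + 1) j (d i x) y + sc ((-1) powi i) (br i (j + 1) x (d j y))"


section \<open>Linear categories\<close>

record ('k, 'o, 'm) lin_cat =
  oscale :: "'k \<Rightarrow> 'o \<Rightarrow> 'o"
  ascale :: "'k \<Rightarrow> 'm \<Rightarrow> 'm"
  Ob :: "'o set"
  Ar :: "'m set"
  src :: "'m \<Rightarrow> 'o"
  tgt :: "'m \<Rightarrow> 'o"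
  idn :: "'o \<Rightarrow> 'm" ("\<one>\<index>")
  comp :: "'m \<Rightarrow> 'm \<Rightarrow> 'm" (infixr "\<bullet>\<index>" 60)

text \<open>
  \<open>g \<bullet> f\<close> is \<open>g\<close> after \<open>f\<close>, meaningful when \<open>src g = tgt f\<close>. The last assumption is
  linearity of composition on the fibre product of arrows over objects.
\<close>

locale linear_category =
  ob: vector_space "oscale C" + ar: vector_space "ascale C"
  for C :: "('k::field, 'o::ab_group_add, 'm::ab_group_add, 'z) lin_cat_scheme" (structure) +
  assumes subspace_Ob: "ob.subspace (Ob C)"
    and subspace_Ar: "ar.subspace (Ar C)"
    and src_linear: "linear_on (ascale C) (oscale C) (Ar C) (Ob C) (src C)"
    and tgt_linear: "linear_on (ascale C) (oscale C) (Ar C) (Ob C) (tgt C)"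
    and idn_linear: "linear_on (oscale C) (ascale C) (Ob C) (Ar C) \<one>"
    and src_idn: "x \<in> Ob C \<Longrightarrow> src C (\<one> x) = x"
    and tgt_idn: "x \<in> Ob C \<Longrightarrow> tgt C (\<one> x) = x"
    and src_comp: "f \<in> Ar C \<Longrightarrow> g \<in> Ar C \<Longrightarrow> src C g = tgt C f \<Longrightarrow> src C (g \<bullet> f) = src C f"
    and tgt_comp: "f \<in> Ar C \<Longrightarrow> g \<in> Ar C \<Longrightarrow> src C g = tgt C f \<Longrightarrow> tgt C (g \<bullet> f) = tgt C g"
    and comp_idn: "f \<in> Ar C \<Longrightarrow> f \<bullet> \<one> (src C f) = f"
    and idn_comp: "f \<in> Ar C \<Longrightarrow> \<one> (tgt C f) \<bullet> f = f"
    and comp_assoc: "f \<in> Ar C \<Longrightarrow> g \<in> Ar C \<Longrightarrow> h \<in> Ar C \<Longrightarrow>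
      src C g = tgt C f \<Longrightarrow> src C h = tgt C g \<Longrightarrow> (h \<bullet> g) \<bullet> f = h \<bullet> (g \<bullet> f)"
    and comp_linear:
      "linear_on (\<lambda>c. map_prod (ascale C c) (ascale C c)) (ascale C)
        {(g, f). g \<in> Ar C \<and> f \<in> Ar C \<and> src C g = tgt C f} (Ar C) (\<lambda>(g, f). g \<bullet> f)"

definition arr_inv :: "('k, 'o, 'm, 'z) lin_cat_scheme \<Rightarrow> 'm \<Rightarrow> 'm"
  where "arr_inv C f = (THE g. g \<in> Ar C \<and> src C g = tgt C f \<and> tgt C g = src C f \<and>
    g \<bullet>\<^bsub>C\<^esub> f = \<one>\<^bsub>C\<^esub> (src C f) \<and> f \<bullet>\<^bsub>C\<^esub> g = \<one>\<^bsub>C\<^esub> (tgt C f))"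

definition linear_functor ::
  "('k, 'o::ab_group_add, 'm::ab_group_add, 'y) lin_cat_scheme \<Rightarrow>
   ('k, 'p::ab_group_add, 'n::ab_group_add, 'z) lin_cat_scheme \<Rightarrow> ('o \<Rightarrow> 'p) \<Rightarrow> ('m \<Rightarrow> 'n) \<Rightarrow> bool"
  where "linear_functor C D Fo Fa \<longleftrightarrow>
    linear_on (oscale C) (oscale D) (Ob C) (Ob D) Fo \<and>
    linear_on (ascale C) (ascale D) (Ar C) (Ar D) Fa \<and>
    (\<forall>f\<in>Ar C. src D (Fa f) = Fo (src C f) \<and> tgt D (Fa f) = Fo (tgt C f)) \<and>
    (\<forall>x\<in>Ob C. Fa (\<one>\<^bsub>C\<^esub> x) = \<one>\<^bsub>D\<^esub> (Fo x)) \<and>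
    (\<forall>f\<in>Ar C. \<forall>g\<in>Ar C. src C g = tgt C f \<longrightarrow> Fa (g \<bullet>\<^bsub>C\<^esub> f) = Fa g \<bullet>\<^bsub>D\<^esub> Fa f)"

text \<open>
  A functor \<open>C \<otimes> C \<rightarrow> D\<close> is given by bilinear maps on objects and on arrows compatible with
  the structure maps. In any linear category \<open>g \<bullet> f = g + f - \<one> (src g)\<close>, so compatibility with
  the composition of \<open>C \<otimes> C\<close> already follows from linearity; the last clause
  (the interchange law) says in addition that the maps form a functor \<open>C \<times> C \<rightarrow> D\<close>.
\<close>

definition bilinear_functor ::
  "('k, 'o::ab_group_add, 'm::ab_group_add, 'y) lin_cat_scheme \<Rightarrow>
   ('k, 'p::ab_group_add, 'n::ab_group_add, 'z) lin_cat_scheme \<Rightarrow>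
   ('o \<Rightarrow> 'o \<Rightarrow> 'p) \<Rightarrow> ('m \<Rightarrow> 'm \<Rightarrow> 'n) \<Rightarrow> bool"
  where "bilinear_functor C D Fo Fa \<longleftrightarrow>
    bilinear_on (oscale C) (oscale C) (oscale D) (Ob C) (Ob C) (Ob D) Fo \<and>
    bilinear_on (ascale C) (ascale C) (ascale D) (Ar C) (Ar C) (Ar D) Fa \<and>
    (\<forall>f\<in>Ar C. \<forall>g\<in>Ar C. src D (Fa f g) = Fo (src C f) (src C g) \<and>
       tgt D (Fa f g) = Fo (tgt C f) (tgt C g)) \<and>
    (\<forall>x\<in>Ob C. \<forall>y\<in>Ob C. Fa (\<one>\<^bsub>C\<^esub> x) (\<one>\<^bsub>C\<^esub> y) = \<one>\<^bsub>D\<^esub> (Fo x y)) \<and>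
    (\<forall>f\<in>Ar C. \<forall>g\<in>Ar C. \<forall>f'\<in>Ar C. \<forall>g'\<in>Ar C. src C f' = tgt C f \<longrightarrow> src C g' = tgt C g \<longrightarrow>
       Fa (f' \<bullet>\<^bsub>C\<^esub> f) (g' \<bullet>\<^bsub>C\<^esub> g) = Fa f' g' \<bullet>\<^bsub>D\<^esub> Fa f g)"

text \<open>
  Natural transformations between functors \<open>C \<otimes> C \<rightarrow> D\<close> and \<open>C \<otimes> C \<otimes> C \<rightarrow> D\<close>; by linearity
  it suffices to require naturality on pure tensors of arrows.
\<close>

definition bilinear_transf ::
  "('k, 'o::ab_group_add, 'm::ab_group_add, 'y) lin_cat_scheme \<Rightarrow>
   ('k, 'p::ab_group_add, 'n::ab_group_add, 'z) lin_cat_scheme \<Rightarrow>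
   ('o \<Rightarrow> 'o \<Rightarrow> 'p) \<Rightarrow> ('m \<Rightarrow> 'm \<Rightarrow> 'n) \<Rightarrow> ('o \<Rightarrow> 'o \<Rightarrow> 'p) \<Rightarrow> ('m \<Rightarrow> 'm \<Rightarrow> 'n) \<Rightarrow>
   ('o \<Rightarrow> 'o \<Rightarrow> 'n) \<Rightarrow> bool"
  where "bilinear_transf C D Fo Fa Go Ga \<alpha> \<longleftrightarrow>
    bilinear_on (oscale C) (oscale C) (ascale D) (Ob C) (Ob C) (Ar D) \<alpha> \<and>
    (\<forall>x\<in>Ob C. \<forall>y\<in>Ob C. src D (\<alpha> x y) = Fo x y \<and> tgt D (\<alpha> x y) = Go x y) \<and>
    (\<forall>f\<in>Ar C. \<forall>g\<in>Ar C.
       \<alpha> (tgt C f) (tgt C g) \<bullet>\<^bsub>D\<^esub> Fa f g = Ga f g \<bullet>\<^bsub>D\<^esub> \<alpha> (src C f) (src C g))"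

definition trilinear_transf ::
  "('k, 'o::ab_group_add, 'm::ab_group_add, 'y) lin_cat_scheme \<Rightarrow>
   ('k, 'p::ab_group_add, 'n::ab_group_add, 'z) lin_cat_scheme \<Rightarrow>
   ('o \<Rightarrow> 'o \<Rightarrow> 'o \<Rightarrow> 'p) \<Rightarrow> ('m \<Rightarrow> 'm \<Rightarrow> 'm \<Rightarrow> 'n) \<Rightarrow>
   ('o \<Rightarrow> 'o \<Rightarrow> 'o \<Rightarrow> 'p) \<Rightarrow> ('m \<Rightarrow> 'm \<Rightarrow> 'm \<Rightarrow> 'n) \<Rightarrow>
   ('o \<Rightarrow> 'o \<Rightarrow> 'o \<Rightarrow> 'n) \<Rightarrow> bool"
  where "trilinear_transf C D Fo Fa Go Ga \<alpha> \<longleftrightarrow>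
    trilinear_on (oscale C) (ascale D) (Ob C) (Ar D) \<alpha> \<and>
    (\<forall>x\<in>Ob C. \<forall>y\<in>Ob C. \<forall>z\<in>Ob C. src D (\<alpha> x y z) = Fo x y z \<and> tgt D (\<alpha> x y z) = Go x y z) \<and>
    (\<forall>f\<in>Ar C. \<forall>g\<in>Ar C. \<forall>h\<in>Ar C.
       \<alpha> (tgt C f) (tgt C g) (tgt C h) \<bullet>\<^bsub>D\<^esub> Fa f g h =
       Ga f g h \<bullet>\<^bsub>D\<^esub> \<alpha> (src C f) (src C g) (src C h))"


section \<open>Lie 2-algebras\<close>

record ('k, 'o, 'm) lie2 = "('k, 'o, 'm) lin_cat" +
  obr :: "'o \<Rightarrow> 'o \<Rightarrow> 'o" ("\<lbrace>_,_\<rbrace>\<index>")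
  abr :: "'m \<Rightarrow> 'm \<Rightarrow> 'm" ("\<lbrakk>_,_\<rbrakk>\<index>")
  alt :: "'o \<Rightarrow> 'o \<Rightarrow> 'm" ("\<S>\<index>")
  jac :: "'o \<Rightarrow> 'o \<Rightarrow> 'o \<Rightarrow> 'm" ("\<J>\<index>")

text \<open>
  The bracket functor is \<open>\<lbrace>x,y\<rbrace>\<close> on objects and \<open>\<lbrakk>f,g\<rbrakk>\<close> on arrows. An object occurring in
  an arrow expression denotes its identity arrow, which is written out here. The Jacobiator with
  hat is \<open>jac_hat\<close>.
\<close>

definition jac_hat :: "('k, 'o, 'm::ab_group_add, 'z) lie2_scheme \<Rightarrow> 'o \<Rightarrow> 'o \<Rightarrow> 'o \<Rightarrow> 'm"
  where "jac_hat L x y z = arr_inv L (\<J>\<^bsub>L\<^esub> x y z) - \<one>\<^bsub>L\<^esub> \<lbrace>y,\<lbrace>x,z\<rbrace>\<^bsub>L\<^esub>\<rbrace>\<^bsub>L\<^esub>"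

locale lie2_algebra = linear_category L
  for L :: "('k::field, 'o::ab_group_add, 'm::ab_group_add, 'z) lie2_scheme" (structure) +
  assumes bracket_functor: "bilinear_functor L L (obr L) (abr L)"
    and alternator: "bilinear_transf L L
      (\<lambda>x y. \<lbrace>x,y\<rbrace>) (\<lambda>f g. \<lbrakk>f,g\<rbrakk>) (\<lambda>x y. - \<lbrace>y,x\<rbrace>) (\<lambda>f g. - \<lbrakk>g,f\<rbrakk>) \<S>"
    and jacobiator: "trilinear_transf L L
      (\<lambda>x y z. \<lbrace>x,\<lbrace>y,z\<rbrace>\<rbrace>) (\<lambda>f g h. \<lbrakk>f,\<lbrakk>g,h\<rbrakk>\<rbrakk>)
      (\<lambda>x y z. \<lbrace>\<lbrace>x,y\<rbrace>,z\<rbrace> + \<lbrace>y,\<lbrace>x,z\<rbrace>\<rbrace>) (\<lambda>f g h. \<lbrakk>\<lbrakk>f,g\<rbrakk>,h\<rbrakk> + \<lbrakk>g,\<lbrakk>f,h\<rbrakk>\<rbrakk>) \<J>"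
    and L1: "\<lbrakk>x \<in> Ob L; y \<in> Ob L; z \<in> Ob L; w \<in> Ob L\<rbrakk> \<Longrightarrow>
      (\<lbrakk>\<J> x y z, \<one> w\<rbrakk> + \<one> \<lbrace>\<lbrace>y,z\<rbrace>,\<lbrace>x,w\<rbrace>\<rbrace> + \<one> \<lbrace>\<lbrace>x,z\<rbrace>,\<lbrace>y,w\<rbrace>\<rbrace> + \<lbrakk>\<one> z, \<J> x y w\<rbrakk>) \<bullet>
      (\<J> x \<lbrace>y,z\<rbrace> w + \<J> x z \<lbrace>y,w\<rbrace>) \<bullet>
      \<lbrakk>\<one> x, \<J> y z w\<rbrakk>
      =
      (\<one> \<lbrace>\<lbrace>\<lbrace>x,y\<rbrace>,z\<rbrace>,w\<rbrace> + \<one> \<lbrace>z,\<lbrace>\<lbrace>x,y\<rbrace>,w\<rbrace>\<rbrace> + \<J> y \<lbrace>x,z\<rbrace> w + \<J> y z \<lbrace>x,w\<rbrace>) \<bullet>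
      (\<J> \<lbrace>x,y\<rbrace> z w + \<lbrakk>\<one> y, \<J> x z w\<rbrakk>) \<bullet>
      \<J> x y \<lbrace>z,w\<rbrace>"
    and L2: "\<lbrakk>x \<in> Ob L; y \<in> Ob L; z \<in> Ob L\<rbrakk> \<Longrightarrow>
      (- jac_hat L y x z) \<bullet> \<lbrakk>\<S> x y, \<one> z\<rbrakk> = jac_hat L x y z"
    and L3: "\<lbrakk>x \<in> Ob L; y \<in> Ob L; z \<in> Ob L\<rbrakk> \<Longrightarrow>
      (- \<J> x z y) \<bullet> \<lbrakk>\<one> x, \<S> y z\<rbrakk> = (\<S> \<lbrace>x,y\<rbrace> z + \<S> y \<lbrace>x,z\<rbrace>) \<bullet> \<J> x y z"
    and L4: "\<lbrakk>x \<in> Ob L; y \<in> Ob L; z \<in> Ob L\<rbrakk> \<Longrightarrow>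
      (- \<S> \<lbrace>y,z\<rbrace> x) \<bullet> \<S> x \<lbrace>y,z\<rbrace> = \<one> \<lbrace>x,\<lbrace>y,z\<rbrace>\<rbrace>"

locale hemistrict_lie2_algebra = lie2_algebra L
  for L :: "('k::field, 'o::ab_group_add, 'm::ab_group_add, 'z) lie2_scheme" (structure) +
  assumes jac_trivial: "\<lbrakk>x \<in> Ob L; y \<in> Ob L; z \<in> Ob L\<rbrakk> \<Longrightarrow> \<J> x y z = \<one> \<lbrace>x,\<lbrace>y,z\<rbrace>\<rbrace>"

definition lie2_morphism ::
  "('k::field, 'o::ab_group_add, 'm::ab_group_add, 'y) lie2_scheme \<Rightarrow>
   ('k, 'p::ab_group_add, 'n::ab_group_add, 'z) lie2_scheme \<Rightarrow>
   ('o \<Rightarrow> 'p) \<Rightarrow> ('m \<Rightarrow> 'n) \<Rightarrow> ('o \<Rightarrow> 'o \<Rightarrow> 'n) \<Rightarrow> bool"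
  where "lie2_morphism L L' Fo Fa F2 \<longleftrightarrow>
    lie2_algebra L \<and> lie2_algebra L' \<and> linear_functor L L' Fo Fa \<and>
    bilinear_transf L L'
      (\<lambda>x y. \<lbrace>Fo x,Fo y\<rbrace>\<^bsub>L'\<^esub>) (\<lambda>f g. \<lbrakk>Fa f,Fa g\<rbrakk>\<^bsub>L'\<^esub>) (\<lambda>x y. Fo \<lbrace>x,y\<rbrace>\<^bsub>L\<^esub>) (\<lambda>f g. Fa \<lbrakk>f,g\<rbrakk>\<^bsub>L\<^esub>) F2 \<and>
    (\<forall>x\<in>Ob L. \<forall>y\<in>Ob L.
      Fa (\<S>\<^bsub>L\<^esub> x y) \<bullet>\<^bsub>L'\<^esub> F2 x y = (- F2 y x) \<bullet>\<^bsub>L'\<^esub> \<S>\<^bsub>L'\<^esub> (Fo x) (Fo y)) \<and>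
    (\<forall>x\<in>Ob L. \<forall>y\<in>Ob L. \<forall>z\<in>Ob L.
      Fa (\<J>\<^bsub>L\<^esub> x y z) \<bullet>\<^bsub>L'\<^esub> F2 x \<lbrace>y,z\<rbrace>\<^bsub>L\<^esub> \<bullet>\<^bsub>L'\<^esub> \<lbrakk>\<one>\<^bsub>L'\<^esub> (Fo x), F2 y z\<rbrakk>\<^bsub>L'\<^esub>
      =
      (F2 \<lbrace>x,y\<rbrace>\<^bsub>L\<^esub> z + F2 y \<lbrace>x,z\<rbrace>\<^bsub>L\<^esub>) \<bullet>\<^bsub>L'\<^esub>
      (\<lbrakk>F2 x y, \<one>\<^bsub>L'\<^esub> (Fo z)\<rbrakk>\<^bsub>L'\<^esub> + \<lbrakk>\<one>\<^bsub>L'\<^esub> (Fo y), F2 x z\<rbrakk>\<^bsub>L'\<^esub>) \<bullet>\<^bsub>L'\<^esub>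
      \<J>\<^bsub>L'\<^esub> (Fo x) (Fo y) (Fo z))"

text \<open>A Lie algebra \<open>g\<close> as a Lie 2-algebra with only identity arrows: an arrow is identified with the object it is the identity of.\<close>

definition discrete_lie2 ::
  "('k \<Rightarrow> 'g \<Rightarrow> 'g) \<Rightarrow> 'g set \<Rightarrow> ('g \<Rightarrow> 'g \<Rightarrow> 'g) \<Rightarrow> ('k, 'g, 'g) lie2"
  where "discrete_lie2 sc g br =
    \<lparr>oscale = sc, ascale = sc, Ob = g, Ar = g, src = (\<lambda>T. T), tgt = (\<lambda>T. T), idn = (\<lambda>T. T),
     comp = (\<lambda>U T. T), obr = br, abr = br, alt = br, jac = (\<lambda>T U W. br T (br U W))\<rparr>"


section \<open>The linear category of a 2-term complex\<close>

text \<open>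
  The complex is \<open>d : C1 \<rightarrow> C0\<close>, where \<open>C1\<close> sits in degree \<open>-1\<close>; an arrow \<open>(x, a)\<close> has source
  \<open>x\<close> and target \<open>x + d a\<close>.
\<close>

definition Gamma ::
  "('k \<Rightarrow> 'a \<Rightarrow> 'a) \<Rightarrow> ('k \<Rightarrow> 'b \<Rightarrow> 'b) \<Rightarrow> 'a set \<Rightarrow> 'b set \<Rightarrow> ('a::ab_group_add \<Rightarrow> 'b::ab_group_add) \<Rightarrow>
    ('k, 'b, 'b \<times> 'a) lin_cat"
  where "Gamma s1 s0 C1 C0 d =
    \<lparr>oscale = s0, ascale = (\<lambda>c. map_prod (s0 c) (s1 c)), Ob = C0, Ar = C0 \<times> C1,
     src = (\<lambda>(x, a). x), tgt = (\<lambda>(x, a). x + d a), idn = (\<lambda>x. (x, 0)),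
     comp = (\<lambda>(y, b) (x, a). (x, a + b))\<rparr>"

text \<open>
  The bracket \<open>[(x,a),(y,b)] = ([x,y], [x,b] + [a,y] + [a,b])\<close> with derived bracket
  \<open>[a,b] = [d a,b]\<close>, the alternator \<open>([x,y], -\<langle>x,y\<rangle>)\<close> and the trivial Jacobiator. The arguments
  \<open>b00\<close>, \<open>b01\<close>, \<open>b10\<close> are the brackets \<open>[x,y]\<close>, \<open>[x,a]\<close>, \<open>[a,x]\<close>.
\<close>

definition Gamma_lie2 ::
  "('k \<Rightarrow> 'a \<Rightarrow> 'a) \<Rightarrow> ('k \<Rightarrow> 'b \<Rightarrow> 'b) \<Rightarrow> 'a set \<Rightarrow> 'b set \<Rightarrow> ('a::ab_group_add \<Rightarrow> 'b::ab_group_add) \<Rightarrow>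
    ('b \<Rightarrow> 'b \<Rightarrow> 'b) \<Rightarrow> ('b \<Rightarrow> 'a \<Rightarrow> 'a) \<Rightarrow> ('a \<Rightarrow> 'b \<Rightarrow> 'a) \<Rightarrow> ('b \<Rightarrow> 'b \<Rightarrow> 'a) \<Rightarrow>
    ('k, 'b, 'b \<times> 'a) lie2"
  where "Gamma_lie2 s1 s0 C1 C0 d b00 b01 b10 pairing =
    lin_cat.extend (Gamma s1 s0 C1 C0 d)
      (lie2.fields
        b00
        (\<lambda>(x, a) (y, b). (b00 x y, b01 x b + b10 a y + b01 (d a) b))
        (\<lambda>x y. (b00 x y, - pairing x y))
        (\<lambda>x y z. (b00 x (b00 y z), 0)))"

text \<open>
  Action of a Lie algebra \<open>g\<close> by strict derivations on a Lie 2-algebra \<open>G\<close> of the form above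
  with pairing \<open>\<langle>x,y\<rangle>\<close>. The element \<open>T\<close> acts by \<open>act0 T\<close> on objects and by
  \<open>(x, a) \<mapsto> (act0 T x, act1 T a)\<close> on arrows.
\<close>

definition acts_by_strict_derivations ::
  "('k \<Rightarrow> 'g \<Rightarrow> 'g) \<Rightarrow> 'g set \<Rightarrow> ('g::ab_group_add \<Rightarrow> 'g \<Rightarrow> 'g) \<Rightarrow>
   ('k, 'b::ab_group_add, 'b \<times> 'a::ab_group_add, 'z) lie2_scheme \<Rightarrow> ('b \<Rightarrow> 'b \<Rightarrow> 'a) \<Rightarrow>
   ('g \<Rightarrow> 'b \<Rightarrow> 'b) \<Rightarrow> ('g \<Rightarrow> 'a \<Rightarrow> 'a) \<Rightarrow> bool"
  where "acts_by_strict_derivations sc g br G pairing act0 act1 \<longleftrightarrow>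
    (let act = (\<lambda>T. map_prod (act0 T) (act1 T)) in
      (\<forall>T\<in>g. linear_functor G G (act0 T) (act T)) \<and>
      (\<forall>x\<in>Ob G. linear_on sc (oscale G) g (Ob G) (\<lambda>T. act0 T x)) \<and>
      (\<forall>f\<in>Ar G. linear_on sc (ascale G) g (Ar G) (\<lambda>T. act T f)) \<and>
      (\<forall>T\<in>g. \<forall>U\<in>g. \<forall>x\<in>Ob G. act0 (br T U) x = act0 T (act0 U x) - act0 U (act0 T x)) \<and>
      (\<forall>T\<in>g. \<forall>U\<in>g. \<forall>f\<in>Ar G. act (br T U) f = act T (act U f) - act U (act T f)) \<and>
      (\<forall>T\<in>g. \<forall>f\<in>Ar G. \<forall>h\<in>Ar G. act T \<lbrakk>f,h\<rbrakk>\<^bsub>G\<^esub> = \<lbrakk>act T f,h\<rbrakk>\<^bsub>G\<^esub> + \<lbrakk>f,act T h\<rbrakk>\<^bsub>G\<^esub>) \<and>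
      (\<forall>T\<in>g. \<forall>x\<in>Ob G. \<forall>y\<in>Ob G.
        act1 T (pairing x y) = pairing (act0 T x) y + pairing x (act0 T y)))"

end

theory Submission
  imports Defs
begin

text \<open>
  Everything follows from the graded Jacobi identity and the Leibniz rule once two
  observations are made. The bracket of degrees \<open>-1\<close> and \<open>-2\<close> vanishes for degree reasons, so applying
  \<open>d\<close> to it gives \<open>{x, da} = {dx, a}\<close>: this is the naturality of the alternator. Since \<open>V 1 = 0\<close>,
  every \<open>T\<close> of degree \<open>0\<close> is closed and \<open>{T, _}\<close> commutes with \<open>d\<close>; hence \<open>d {dx, y} = {dx, dy}\<close>, which
  turns the Jacobi identity into the Leibniz identity for \<open>[x, y] = {dx, y}\<close>.
\<close>

lemma linear_onI:
  assumes "\<And>x. x \<in> A \<Longrightarrow> f x \<in> B"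
    and "\<And>x y. x \<in> A \<Longrightarrow> y \<in> A \<Longrightarrow> f (x + y) = f x + f y"
    and "\<And>c x. x \<in> A \<Longrightarrow> f (s c x) = t c (f x)"
  shows "linear_on s t A B f"
  using assms by (simp add: linear_on_def)

section \<open>The linear category of a 2-term complex\<close>

lemma Gamma_lie2_simps [simp]:
  "oscale (Gamma_lie2 s1 s0 C1 C0 d b00 b01 b10 p) = s0"
  "ascale (Gamma_lie2 s1 s0 C1 C0 d b00 b01 b10 p) = (\<lambda>c. map_prod (s0 c) (s1 c))"
  "Ob (Gamma_lie2 s1 s0 C1 C0 d b00 b01 b10 p) = C0"
  "Ar (Gamma_lie2 s1 s0 C1 C0 d b00 b01 b10 p) = C0 \<times> C1"
  "src (Gamma_lie2 s1 s0 C1 C0 d b00 b01 b10 p) (x, a) = x"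
  "tgt (Gamma_lie2 s1 s0 C1 C0 d b00 b01 b10 p) (x, a) = x + d a"
  "idn (Gamma_lie2 s1 s0 C1 C0 d b00 b01 b10 p) x = (x, 0)"
  "comp (Gamma_lie2 s1 s0 C1 C0 d b00 b01 b10 p) (y, b) (x, a) = (x, a + b)"
  "obr (Gamma_lie2 s1 s0 C1 C0 d b00 b01 b10 p) = b00"
  "abr (Gamma_lie2 s1 s0 C1 C0 d b00 b01 b10 p) (x, a) (y, b) =
     (b00 x y, b01 x b + b10 a y + b01 (d a) b)"
  "alt (Gamma_lie2 s1 s0 C1 C0 d b00 b01 b10 p) = (\<lambda>x y. (b00 x y, - p x y))"
  "jac (Gamma_lie2 s1 s0 C1 C0 d b00 b01 b10 p) = (\<lambda>x y z. (b00 x (b00 y z), 0))"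
  by (simp_all add: Gamma_lie2_def Gamma_def lin_cat.extend_def lie2.fields_def)

lemma vector_space_map_prod:
  assumes "vector_space s" "vector_space t"
  shows "vector_space (\<lambda>c. map_prod (s c) (t c))"
proof -
  interpret s: vector_space s by fact
  interpret t: vector_space t by fact
  show ?thesis
    by unfold_locales
      (auto simp: s.scale_right_distrib t.scale_right_distrib s.scale_left_distrib t.scale_left_distrib)
qed

lemma linear_category_Gamma_lie2:
  assumes s1: "vector_space s1" and s0: "vector_space s0"
    and C1: "module.subspace s1 C1" and C0: "module.subspace s0 C0"
    and d: "linear_on s1 s0 C1 C0 d"
  shows "linear_category (Gamma_lie2 s1 s0 C1 C0 d b00 b01 b10 p)"
proof -
  interpret v1: vector_space s1 by fact
  interpret v0: vector_space s0 by fact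
  interpret v: vector_space "\<lambda>c. map_prod (s0 c) (s1 c)"
    by (rule vector_space_map_prod) fact+
  note C1' [simp] = v1.subspace_0[OF C1] v1.subspace_add[OF C1] v1.subspace_scale[OF C1]
  note C0' [simp] = v0.subspace_0[OF C0] v0.subspace_add[OF C0] v0.subspace_scale[OF C0]
  have d_mem [simp]: "d a \<in> C0" if "a \<in> C1" for a
    using d that by (simp add: linear_on_def)
  have d_add [simp]: "d (a + b) = d a + d b" if "a \<in> C1" "b \<in> C1" for a b
    using d that by (simp add: linear_on_def)
  have d_scale [simp]: "d (s1 c a) = s0 c (d a)" if "a \<in> C1" for c a
    using d that by (simp add: linear_on_def)
  have d_0 [simp]: "d 0 = 0"
    using d_add[of 0 0] by (simp del: d_add)
  show ?thesis
    by (rule linear_category.intro; (rule linear_category_axioms.intro)?)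
      (auto simp: v1.vector_space_axioms v0.vector_space_axioms v.vector_space_axioms
      C0 v.subspace_def zero_prod_def v0.scale_right_distrib v1.scale_right_distrib ac_simps
      intro!: linear_onI)
qed

text \<open>The trivial Jacobiator consists of identity arrows, so these are the inverses that
  \<open>jac_hat\<close> takes.\<close>

lemma arr_inv_Gamma_lie2_idn:
  assumes "x \<in> C0" "0 \<in> C1" "d 0 = (0::'b::ab_group_add)"
  shows "arr_inv (Gamma_lie2 s1 s0 C1 C0 d b00 b01 b10 p) (x, 0) = (x, 0)"
  unfolding arr_inv_def
  by (rule the_equality) (use assms in auto)

section \<open>Lie algebras as discrete Lie 2-algebras\<close>

lemma discrete_lie2_simps [simp]:
  "oscale (discrete_lie2 sc g br) = sc" "ascale (discrete_lie2 sc g br) = sc"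
  "Ob (discrete_lie2 sc g br) = g" "Ar (discrete_lie2 sc g br) = g"
  "src (discrete_lie2 sc g br) T = T" "tgt (discrete_lie2 sc g br) T = T"
  "idn (discrete_lie2 sc g br) T = T" "comp (discrete_lie2 sc g br) U T = T"
  "obr (discrete_lie2 sc g br) = br" "abr (discrete_lie2 sc g br) = br"
  "alt (discrete_lie2 sc g br) = br"
  "jac (discrete_lie2 sc g br) = (\<lambda>T U W. br T (br U W))"
  by (simp_all add: discrete_lie2_def)

lemma arr_inv_discrete_lie2:
  assumes "T \<in> g"
  shows "arr_inv (discrete_lie2 sc g br) T = T"
  unfolding arr_inv_def by (rule the_equality) (use assms in auto)

text \<open>Arrows join only equal objects, so the target conditions on alternator and Jacobiator
  are antisymmetry and the Jacobi identity. A composite equals its rightmost factor, so each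
  coherence law compares two elements of \<open>g\<close>.\<close>

lemma lie2_algebra_discrete_lie2:
  assumes sc: "vector_space sc" and g: "module.subspace sc g"
    and br: "bilinear_on sc sc sc g g g br"
    and antisym: "\<And>T U. T \<in> g \<Longrightarrow> U \<in> g \<Longrightarrow> br T U = - br U T"
    and jacobi: "\<And>T U W. T \<in> g \<Longrightarrow> U \<in> g \<Longrightarrow> W \<in> g \<Longrightarrow>
      br T (br U W) = br (br T U) W + br U (br T W)"
  shows "lie2_algebra (discrete_lie2 sc g br)"
proof -
  interpret vector_space sc by fact
  note [simp] = subspace_0[OF g] subspace_add[OF g] subspace_scale[OF g]
  have [simp]: "br T U \<in> g" "br (T + W) U = br T U + br W U" "br U (T + W) = br U T + br U W"
    "br (sc c T) U = sc c (br T U)" "br T (sc c U) = sc c (br T U)"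
    if "T \<in> g" "U \<in> g" "W \<in> g" for T U W c
    using br that by (simp_all add: bilinear_on_def linear_on_def)
  have "linear_category (discrete_lie2 sc g br)"
    by (rule linear_category.intro; (rule linear_category_axioms.intro)?)
      (auto simp: vector_space_axioms g intro!: linear_onI)
  moreover have "jac_hat (discrete_lie2 sc g br) T U W = br (br T U) W"
    if "T \<in> g" "U \<in> g" "W \<in> g" for T U W
    using that jacobi[of T U W] by (simp add: jac_hat_def arr_inv_discrete_lie2)
  \<comment> \<open>Antisymmetry and Jacobi enter reversed, folding targets back into
    sources.\<close>
  ultimately show ?thesis
    by (intro lie2_algebra.intro lie2_algebra_axioms.intro)
      (simp_all add: bilinear_functor_def bilinear_transf_def trilinear_transf_def trilinear_on_def
        linear_on_def br antisym[symmetric] jacobi[symmetric])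
qed

section \<open>Bracket and differential in degrees -2, -1 and 0\<close>

locale three_term_dgla = dgla sc V d br
  for sc :: "'k::field \<Rightarrow> 'v::ab_group_add \<Rightarrow> 'v" and V d br +
  assumes V_trivial: "i \<notin> {-2, -1, 0} \<Longrightarrow> V i = {0}"
begin

lemma V_closed [simp]:
  "0 \<in> V i" "x \<in> V i \<Longrightarrow> y \<in> V i \<Longrightarrow> x + y \<in> V i" "x \<in> V i \<Longrightarrow> sc c x \<in> V i"
  "x \<in> V i \<Longrightarrow> - x \<in> V i"
  using subspace_V[of i] by (simp_all add: subspace_0 subspace_add subspace_scale subspace_neg)

lemma br_linear:
  assumes "x \<in> V i" "y \<in> V j"
  shows "x' \<in> V i \<Longrightarrow> br i j (x + x') y = br i j x y + br i j x' y"
    "y' \<in> V j \<Longrightarrow> br i j x (y + y') = br i j x y + br i j x y'"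
    "br i j (sc c x) y = sc c (br i j x y)"
    "br i j x (sc c y) = sc c (br i j x y)"
  using br_bilinear[of i j] assms by (simp_all add: bilinear_on_def linear_on_def)

lemma br_zero_left [simp]: "y \<in> V j \<Longrightarrow> br i j 0 y = 0"
  using br_linear(1)[of 0 i y j 0] by simp

lemma br_zero_right [simp]: "x \<in> V i \<Longrightarrow> br i j x 0 = 0"
  using br_linear(2)[of x i 0 j 0] by simp

lemma br_minus:
  assumes "x \<in> V i" "y \<in> V j"
  shows "br i j (- x) y = - br i j x y" "br i j x (- y) = - br i j x y"
  using br_linear(3)[of x i y j "- 1"] br_linear(4)[of x i y j "- 1"] assms by simp_all

lemma br_mem: "x \<in> V i \<Longrightarrow> y \<in> V j \<Longrightarrow> br i j x y \<in> V (i + j)"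
  using br_bilinear[of i j] by (simp add: bilinear_on_def linear_on_def)

lemma br_closed [simp]:
  "T \<in> V 0 \<Longrightarrow> x \<in> V i \<Longrightarrow> br 0 i T x \<in> V i"
  "x \<in> V (-1) \<Longrightarrow> y \<in> V (-1) \<Longrightarrow> br (-1) (-1) x y \<in> V (-2)"
  using br_mem[of T 0 x i] br_mem[of x "-1" y "-1"] by simp_all

lemma d_add_scale:
  assumes "x \<in> V i"
  shows "y \<in> V i \<Longrightarrow> d i (x + y) = d i x + d i y" "d i (sc c x) = sc c (d i x)"
  using d_linear[of i] assms by (simp_all add: linear_on_def)

lemma d_closed [simp]:
  "a \<in> V (-2) \<Longrightarrow> d (-2) a \<in> V (-1)" "x \<in> V (-1) \<Longrightarrow> d (-1) x \<in> V 0"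
  using d_linear[of "-2"] d_linear[of "-1"] by (simp_all add: linear_on_def)

lemma d_zero [simp]: "d i 0 = 0"
  using d_add_scale(1)[of 0 i 0] by simp

lemma d_minus: "x \<in> V i \<Longrightarrow> d i (- x) = - d i x"
  using d_add_scale(2)[of x i "- 1"] by simp

lemma d_d_degree_minus2 [simp]: "a \<in> V (-2) \<Longrightarrow> d (-1) (d (-2) a) = 0"
  using d_d[of a "-2"] by simp

lemma d_degree_0: "T \<in> V 0 \<Longrightarrow> d 0 T = 0"
  using d_linear[of 0] V_trivial[of 1] by (simp add: linear_on_def)

text \<open>The first case yields \<open>d [x,y] = {dx,dy}\<close> and the equivariance of the
  boundary functor; the second makes the action of \<open>T\<close> respect targets.\<close>

lemma d_action:
  assumes "T \<in> V 0"
  shows "x \<in> V (-1) \<Longrightarrow> d (-1) (br 0 (-1) T x) = br 0 0 T (d (-1) x)"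
    and "a \<in> V (-2) \<Longrightarrow> d (-2) (br 0 (-2) T a) = br 0 (-1) T (d (-2) a)"
  using d_br[of T 0 x "-1"] d_br[of T 0 a "-2"] assms by (simp_all add: d_degree_0)

text \<open>As \<open>T\<close> has degree 0, the sign in \<open>br_jacobi\<close> is 1. The first
  case is behind the Leibniz identity, the second behind L3.\<close>

lemma action_br:
  assumes "T \<in> V 0"
  shows "U \<in> V 0 \<Longrightarrow> x \<in> V i \<Longrightarrow> br 0 i T (br 0 i U x) = br 0 i (br 0 0 T U) x + br 0 i U (br 0 i T x)"
    and "x \<in> V (-1) \<Longrightarrow> y \<in> V (-1) \<Longrightarrow>
      br 0 (-2) T (br (-1) (-1) x y) = br (-1) (-1) (br 0 (-1) T x) y + br (-1) (-1) x (br 0 (-1) T y)"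
  using br_jacobi[of T 0 U 0 x i] br_jacobi[of T 0 x "-1" y "-1"] assms by simp_all

lemma action_commutator:
  "T \<in> V 0 \<Longrightarrow> U \<in> V 0 \<Longrightarrow> x \<in> V i \<Longrightarrow>
    br 0 i (br 0 0 T U) x = br 0 i T (br 0 i U x) - br 0 i U (br 0 i T x)"
  by (simp add: action_br(1)[of T U])

lemma pairing_commute:
  "x \<in> V (-1) \<Longrightarrow> y \<in> V (-1) \<Longrightarrow> br (-1) (-1) x y = br (-1) (-1) y x"
  using br_antisym[of x "-1" y "-1"] by simp

lemma br_0_antisym: "T \<in> V 0 \<Longrightarrow> U \<in> V 0 \<Longrightarrow> br 0 0 T U = - br 0 0 U T"
  using br_antisym[of T 0 U 0] by simp

text \<open>This is the target condition of the alternator: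
  \<open>[x,y] - d <x,y> = - [y,x]\<close>. The Leibniz rule gives \<open>- {x,dy}\<close>, which
  antisymmetry in degrees -1 and 0 turns into \<open>{dy,x}\<close>.\<close>

lemma d_pairing:
  assumes "x \<in> V (-1)" "y \<in> V (-1)"
  shows "d (-2) (br (-1) (-1) x y) = br 0 (-1) (d (-1) x) y + br 0 (-1) (d (-1) y) x"
  using d_br[of x "-1" y "-1"] br_antisym[of x "-1" "d (-1) y" 0] assms by simp

lemma pairing_d:
  assumes "x \<in> V (-1)" "a \<in> V (-2)"
  shows "br (-1) (-1) x (d (-2) a) = br 0 (-2) (d (-1) x) a"
    and "br (-1) (-1) (d (-2) a) x = br 0 (-2) (d (-1) x) a"
proof -
  have "br (-1) (-2) x a = 0"
    using br_mem[OF assms] V_trivial[of "-3"] by simp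
  then show "br (-1) (-1) x (d (-2) a) = br 0 (-2) (d (-1) x) a"
    using d_br[of x "-1" a "-2"] assms by simp
  then show "br (-1) (-1) (d (-2) a) x = br 0 (-2) (d (-1) x) a"
    using assms by (simp add: pairing_commute)
qed

section \<open>The hemistrict Lie 2-algebra\<close>

abbreviation "Gamma_dgla \<equiv> Gamma_lie2 sc sc (V (-2)) (V (-1)) (d (-2))
  (\<lambda>x y. br 0 (-1) (d (-1) x) y) (\<lambda>x a. br 0 (-2) (d (-1) x) a) (\<lambda>a x. 0)
  (\<lambda>x y. br (-1) (-1) x y)"

lemmas lin_simps = br_linear br_minus d_add_scale d_minus scale_right_distrib

lemma lie2_algebra_degree_0: "lie2_algebra (discrete_lie2 sc (V 0) (br 0 0))"
proof (rule lie2_algebra_discrete_lie2)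
  show "bilinear_on sc sc sc (V 0) (V 0) (V 0) (br 0 0)"
    using br_bilinear[of 0 0] by simp
qed (fact vector_space_axioms subspace_V br_0_antisym action_br(1))+

text \<open>Jacobi for \<open>dx\<close> and \<open>dy\<close> acting on \<open>z\<close>. The
  result has the form into which \<open>d_action\<close> brings \<open>[[x,y],z]\<close>, as L2
  requires.\<close>

lemma jac_hat_Gamma_dgla:
  assumes "x \<in> V (-1)" "y \<in> V (-1)" "z \<in> V (-1)"
  shows "jac_hat Gamma_dgla x y z = (br 0 (-1) (br 0 0 (d (-1) x) (d (-1) y)) z, 0)"
  using assms by (simp add: jac_hat_def arr_inv_Gamma_lie2_idn action_br(1)[of "d (-1) x"])

lemma hemistrict_Gamma_dgla: "hemistrict_lie2_algebra Gamma_dgla"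
proof -
  have linear: "linear_category Gamma_dgla"
    using d_linear[of "-2"]
    by (intro linear_category_Gamma_lie2) (simp_all add: vector_space_axioms subspace_V)
  \<comment> \<open>Since \<open>d (da) = 0\<close>, the derived bracket vanishes and source and
    target of an arrow act alike; interchange is then additivity.\<close>
  have bracket: "bilinear_functor Gamma_dgla Gamma_dgla (obr Gamma_dgla) (abr Gamma_dgla)"
    by (auto simp: bilinear_functor_def bilinear_on_def lin_simps d_action intro!: linear_onI)
  \<comment> \<open>In \<open><x + da, y + db>\<close> the mixed terms are \<open>{dx,b}\<close> and
    \<open>{dy,a}\<close> by \<open>pairing_d\<close>, and \<open><da,db>\<close> vanishes.\<close>
  have alternator: "bilinear_transf Gamma_dgla Gamma_dgla (obr Gamma_dgla) (abr Gamma_dgla)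
      (\<lambda>x y. - obr Gamma_dgla y x) (\<lambda>f g. - abr Gamma_dgla g f) (alt Gamma_dgla)"
    by (auto simp: bilinear_transf_def bilinear_on_def lin_simps d_pairing pairing_d intro!: linear_onI)
  \<comment> \<open>The target condition is the Leibniz identity in degree -1, naturality the one in
    degree -2.\<close>
  have jacobiator: "trilinear_transf Gamma_dgla Gamma_dgla
      (\<lambda>x y z. obr Gamma_dgla x (obr Gamma_dgla y z)) (\<lambda>f g h. abr Gamma_dgla f (abr Gamma_dgla g h))
      (\<lambda>x y z. obr Gamma_dgla (obr Gamma_dgla x y) z + obr Gamma_dgla y (obr Gamma_dgla x z))
      (\<lambda>f g h. abr Gamma_dgla (abr Gamma_dgla f g) h + abr Gamma_dgla g (abr Gamma_dgla f h)) (jac Gamma_dgla)"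
    by (auto simp: trilinear_transf_def trilinear_on_def lin_simps d_action action_commutator intro!: linear_onI)
  show ?thesis
  proof (rule hemistrict_lie2_algebra.intro;
      (rule hemistrict_lie2_algebra_axioms.intro lie2_algebra.intro)?;
      (rule lie2_algebra_axioms.intro)?; (unfold Gamma_lie2_simps(3))?)
    fix x y z assume V: "x \<in> V (-1)" "y \<in> V (-1)" "z \<in> V (-1)"
    \<comment> \<open>L3: its degree -2 component says that \<open>{dx,_}\<close> derives the
      pairing.\<close>
    show "(- jac Gamma_dgla x z y) \<bullet>\<^bsub>Gamma_dgla\<^esub> abr Gamma_dgla (idn Gamma_dgla x) (alt Gamma_dgla y z) =
        (alt Gamma_dgla (obr Gamma_dgla x y) z + alt Gamma_dgla y (obr Gamma_dgla x z)) \<bullet>\<^bsub>Gamma_dgla\<^esub> jac Gamma_dgla x y z"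
      using V by (simp add: lin_simps d_action action_br(2))
    \<comment> \<open>L4: the two pairings cancel by symmetry.\<close>
    show "(- alt Gamma_dgla (obr Gamma_dgla y z) x) \<bullet>\<^bsub>Gamma_dgla\<^esub> alt Gamma_dgla x (obr Gamma_dgla y z) = idn Gamma_dgla (obr Gamma_dgla x (obr Gamma_dgla y z))"
      using V pairing_commute[of x "br 0 (-1) (d (-1) y) z"] by simp
  \<comment> \<open>In L1 and L2 all degree -2 components are zero, in L2 because
    \<open>[a,z] = 0\<close> discards the pairing; only sources are compared.\<close>
  qed (use linear bracket alternator jacobiator in \<open>simp_all add: jac_hat_Gamma_dgla d_action\<close>)
qed

section \<open>The boundary morphism and the action\<close>

lemma lie2_morphism_d:
  "lie2_morphism Gamma_dgla (discrete_lie2 sc (V 0) (br 0 0)) (d (-1)) (\<lambda>(x, a). d (-1) x)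
    (\<lambda>x y. br 0 0 (d (-1) x) (d (-1) y))"
proof -
  let ?L0 = "discrete_lie2 sc (V 0) (br 0 0)"
  have "linear_functor Gamma_dgla ?L0 (d (-1)) (\<lambda>(x, a). d (-1) x)"
    by (auto simp: linear_functor_def d_add_scale intro!: linear_onI)
  moreover have "bilinear_transf Gamma_dgla ?L0
      (\<lambda>x y. obr ?L0 (d (-1) x) (d (-1) y))
      (\<lambda>f g. abr ?L0 (case f of (x, a) \<Rightarrow> d (-1) x) (case g of (x, a) \<Rightarrow> d (-1) x))
      (\<lambda>x y. d (-1) (obr Gamma_dgla x y)) (\<lambda>f g. case abr Gamma_dgla f g of (x, a) \<Rightarrow> d (-1) x)
      (\<lambda>x y. br 0 0 (d (-1) x) (d (-1) y))"
    by (auto simp: bilinear_transf_def bilinear_on_def lin_simps d_action intro!: linear_onI)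
  ultimately show ?thesis
    using hemistrict_Gamma_dgla lie2_algebra_degree_0
    by (simp add: lie2_morphism_def hemistrict_lie2_algebra_def d_action br_0_antisym[symmetric])
qed

lemma strict_derivations_Gamma_dgla:
  "acts_by_strict_derivations sc (V 0) (br 0 0) Gamma_dgla (br (-1) (-1)) (br 0 (-1)) (br 0 (-2))"
proof -
  have "linear_functor Gamma_dgla Gamma_dgla (br 0 (-1) T) (map_prod (br 0 (-1) T) (br 0 (-2) T))" if "T \<in> V 0" for T
    using that by (auto simp: linear_functor_def lin_simps d_action intro!: linear_onI)
  then show ?thesis
    by (auto simp: acts_by_strict_derivations_def lin_simps d_action action_commutator action_br(2)
        intro!: linear_onI)
qed

end

theorem theorem5p3:
  fixes sc :: "'k::field_char_0 \<Rightarrow> 'v::ab_group_add \<Rightarrow> 'v"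
    and V :: "int \<Rightarrow> 'v set"
    and d :: "int \<Rightarrow> 'v \<Rightarrow> 'v"
    and br :: "int \<Rightarrow> int \<Rightarrow> 'v \<Rightarrow> 'v \<Rightarrow> 'v"
    and bxx bxa bax pairing :: "'v \<Rightarrow> 'v \<Rightarrow> 'v"
    and G :: "('k, 'v, 'v \<times> 'v) lie2"
    and L0 :: "('k, 'v, 'v) lie2"
    and del_o :: "'v \<Rightarrow> 'v"
    and del_a :: "'v \<times> 'v \<Rightarrow> 'v"
  assumes "dgla sc V d br"
    and "\<forall>i. i \<notin> {-2, -1, 0} \<longrightarrow> V i = {0}"
    and "bxx = (\<lambda>x y. br 0 (-1) (d (-1) x) y)"
    and "bxa = (\<lambda>x a. br 0 (-2) (d (-1) x) a)"
    and "bax = (\<lambda>a x. 0)"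
    and "pairing = (\<lambda>x y. br (-1) (-1) x y)"
    and "G = Gamma_lie2 sc sc (V (-2)) (V (-1)) (d (-2)) bxx bxa bax pairing"
    and "L0 = discrete_lie2 sc (V 0) (br 0 0)"
    and "del_o = (\<lambda>x. d (-1) x)"
    and "del_a = (\<lambda>(x, a). d (-1) x)"
  shows
    \<comment> \<open>the two expressions for the derived bracket agree; (1)\<close>
    "(\<forall>a\<in>V (-2). \<forall>b\<in>V (-2). bxa (d (-2) a) b = bax a (d (-2) b)) \<and>
     hemistrict_lie2_algebra G \<and>
    \<comment> \<open>(2), with the identity as coherence transformation\<close>
     lie2_morphism G L0 del_o del_a (\<lambda>x y. \<one>\<^bsub>L0\<^esub> \<lbrace>del_o x,del_o y\<rbrace>\<^bsub>L0\<^esub>) \<and>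
    \<comment> \<open>(3)\<close>
     acts_by_strict_derivations sc (V 0) (br 0 0) G pairing (br 0 (-1)) (br 0 (-2)) \<and>
    \<comment> \<open>crossed module identities, on objects and on arrows\<close>
     (\<forall>T\<in>V 0. \<forall>x\<in>Ob G. del_o (br 0 (-1) T x) = br 0 0 T (del_o x)) \<and>
     (\<forall>T\<in>V 0. \<forall>f\<in>Ar G. del_a (map_prod (br 0 (-1) T) (br 0 (-2) T) f) = br 0 0 T (del_a f)) \<and>
     (\<forall>x\<in>Ob G. \<forall>y\<in>Ob G. br 0 (-1) (del_o x) y = \<lbrace>x,y\<rbrace>\<^bsub>G\<^esub>) \<and>
     (\<forall>f\<in>Ar G. \<forall>g\<in>Ar G. map_prod (br 0 (-1) (del_a f)) (br 0 (-2) (del_a f)) g = \<lbrakk>f,g\<rbrakk>\<^bsub>G\<^esub>)"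
proof -
  interpret three_term_dgla sc V d br
    using assms(1,2) by (intro three_term_dgla.intro three_term_dgla_axioms.intro) auto
  have "G = Gamma_dgla" and "L0 = discrete_lie2 sc (V 0) (br 0 0)"
    "del_o = d (-1)" "del_a = (\<lambda>(x, a). d (-1) x)" "pairing = br (-1) (-1)"
    by (simp_all add: assms)
  \<comment> \<open>Both derived brackets are zero, one by \<open>d d = 0\<close> and one by
    definition of \<open>bax\<close>. So \<open>[f,g]\<close> has degree -2 component
    \<open>{dx,b}\<close>, as the last identity asks.\<close>
  then show ?thesis
    using hemistrict_Gamma_dgla lie2_morphism_d strict_derivations_Gamma_dgla
    by (auto simp: assms(4,5) d_action)
qed

end
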